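(* Let $(R,\delta)$ be a differential algebra such that $R[\delta]$ is weakly fadelian. Then: (i) $R$ is a division ring; (ii) $R[\delta]$ is fadelian; (iii) every nonzero element of $R[\delta]$ is surjective as an endomorphism of $R$.
   Context: All rings are nontrivial ($1\neq 0$), unital, associative, and not assumed commutative. A ring $A$ is weakly fadelian if for every nonzero $a\in A$ there exist $b,c\in A$ with $1=ab+ca$; it is fadelian if for every $x\in A$ and every nonzero $a\in A$ there exist $b,c\in A$ with $x=ab+ca$. Let $k$ be a commutative field and $R$ a central $k$-algebra (a unital $k$-algebra in which the image of $k$ lies in the centre of $R$). A derivation of $R$ is a nonzero $k$-linear map $\delta:R\to R$ such that $\delta(ab)=\delta(a)b+a\delta(b)$ for all $a,b\in R$; one then says that $(R,\delta)$ is a differential algebra. For $x\in R$, let $\tilde x:R\to R$, $y\mapsto xy$, be left multiplication by $x$. Then $R[\delta]$ denotes the $k$-subalgebra of $\mathrm{End}_k(R)$ (with composition as multiplication) generated by $\delta$ and all $\tilde x$, $x\in R$. *)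

theory Defs
  imports "HOL-Algebra.Module" "HOL-Algebra.Subrings" "HOL-Library.FuncSet"
begin

section \<open>Rings\<close>

locale nontrivial_ring = ring A for A (structure) +
  assumes one_not_zero: "\<one> \<noteq> \<zero>"

locale weakly_fadelian = nontrivial_ring A for A (structure) +
  assumes one_decomp:
    "\<lbrakk> a \<in> carrier A; a \<noteq> \<zero> \<rbrakk> \<Longrightarrow>
      \<exists>b \<in> carrier A. \<exists>c \<in> carrier A. \<one> = a \<otimes> b \<oplus> c \<otimes> a"

locale fadelian = nontrivial_ring A for A (structure) +
  assumes decomp:
    "\<lbrakk> x \<in> carrier A; a \<in> carrier A; a \<noteq> \<zero> \<rbrakk> \<Longrightarrow>
      \<exists>b \<in> carrier A. \<exists>c \<in> carrier A. x = a \<otimes> b \<oplus> c \<otimes> a"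

text \<open>\<^const>\<open>Units\<close> are the two-sided invertible elements.\<close>

locale skew_field = nontrivial_ring A for A (structure) +
  assumes skew_field_Units: "Units A = carrier A - {\<zero>}"


section \<open>Central algebras and their endomorphisms\<close>

text \<open>The library's locale \<^locale>\<open>algebra\<close> only covers commutative algebras.\<close>

locale central_algebra = A?: nontrivial_ring R + K?: field k + module k R
  for k :: "('k, 'c) ring_scheme" (structure)
    and R :: "('k, 'r, 'd) module_scheme" (structure) +
  assumes smult_assoc2:
      "\<lbrakk> a \<in> carrier k; x \<in> carrier R; y \<in> carrier R \<rbrakk> \<Longrightarrow>
        (a \<odot>\<^bsub>R\<^esub> x) \<otimes>\<^bsub>R\<^esub> y = a \<odot>\<^bsub>R\<^esub> (x \<otimes>\<^bsub>R\<^esub> y)"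
    and scalars_central:
      "\<lbrakk> a \<in> carrier k; x \<in> carrier R \<rbrakk> \<Longrightarrow>
        (a \<odot>\<^bsub>R\<^esub> \<one>\<^bsub>R\<^esub>) \<otimes>\<^bsub>R\<^esub> x = x \<otimes>\<^bsub>R\<^esub> (a \<odot>\<^bsub>R\<^esub> \<one>\<^bsub>R\<^esub>)"

text \<open>
  Maps are represented by functions that are \<^const>\<open>undefined\<close> outside the carrier, so that
  equality of functions is equality of maps on \<^term>\<open>carrier R\<close>.
\<close>

definition End_alg ::
    "('k, 'c) ring_scheme \<Rightarrow> ('k, 'r, 'd) module_scheme \<Rightarrow> ('k, 'r \<Rightarrow> 'r) module" where
  "End_alg k R =
    \<lparr> carrier = {f \<in> carrier R \<rightarrow>\<^sub>E carrier R.
        (\<forall>x \<in> carrier R. \<forall>y \<in> carrier R. f (x \<oplus>\<^bsub>R\<^esub> y) = f x \<oplus>\<^bsub>R\<^esub> f y) \<and>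
        (\<forall>a \<in> carrier k. \<forall>x \<in> carrier R. f (a \<odot>\<^bsub>R\<^esub> x) = a \<odot>\<^bsub>R\<^esub> f x)},
      mult = compose (carrier R),
      one = (\<lambda>x \<in> carrier R. x),
      zero = (\<lambda>x \<in> carrier R. \<zero>\<^bsub>R\<^esub>),
      add = (\<lambda>f g. \<lambda>x \<in> carrier R. f x \<oplus>\<^bsub>R\<^esub> g x),
      smult = (\<lambda>a f. \<lambda>x \<in> carrier R. a \<odot>\<^bsub>R\<^esub> f x) \<rparr>"

definition left_mult :: "('r, 'd) ring_scheme \<Rightarrow> 'r \<Rightarrow> 'r \<Rightarrow> 'r" where
  "left_mult R x = (\<lambda>y \<in> carrier R. x \<otimes>\<^bsub>R\<^esub> y)"

definition generated_subalgebra ::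
    "('k, 'c) ring_scheme \<Rightarrow> ('k, 'b, 'd) module_scheme \<Rightarrow> 'b set \<Rightarrow> 'b set" where
  "generated_subalgebra k A X = \<Inter>{S. subring S A \<and> submodule S k A \<and> X \<subseteq> S}"


section \<open>Differential algebras\<close>

locale differential_algebra = central_algebra k R
  for k (structure) and R (structure) and \<delta> +
  assumes deriv_linear: "\<delta> \<in> carrier (End_alg k R)"
    and deriv_nonzero: "\<delta> \<noteq> \<zero>\<^bsub>End_alg k R\<^esub>"
    and deriv_mult:
      "\<lbrakk> a \<in> carrier R; b \<in> carrier R \<rbrakk> \<Longrightarrow>
        \<delta> (a \<otimes>\<^bsub>R\<^esub> b) = \<delta> a \<otimes>\<^bsub>R\<^esub> b \<oplus>\<^bsub>R\<^esub> a \<otimes>\<^bsub>R\<^esub> \<delta> b"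

definition diff_op_algebra ::
    "('k, 'c) ring_scheme \<Rightarrow> ('k, 'r, 'd) module_scheme \<Rightarrow> ('r \<Rightarrow> 'r)
      \<Rightarrow> ('k, 'r \<Rightarrow> 'r) module" where
  "diff_op_algebra k R \<delta> =
    (End_alg k R)
      \<lparr> carrier := generated_subalgebra k (End_alg k R)
          (insert \<delta> (left_mult R ` carrier R)) \<rparr>"


section \<open>Well-definedness\<close>

text \<open>
  The ring axioms and \<open>1 \<noteq> 0\<close> built into \<^locale>\<open>weakly_fadelian\<close> hold automatically for
  \<^const>\<open>diff_op_algebra\<close>, and the generators do lie in \<^const>\<open>End_alg\<close>.
\<close>

lemma (in central_algebra) smult_assoc3:
  assumes "a \<in> carrier k" "x \<in> carrier R" "y \<in> carrier R"
  shows "x \<otimes>\<^bsub>R\<^esub> (a \<odot>\<^bsub>R\<^esub> y) = a \<odot>\<^bsub>R\<^esub> (x \<otimes>\<^bsub>R\<^esub> y)"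
proof -
  have c: "a \<odot>\<^bsub>R\<^esub> \<one>\<^bsub>R\<^esub> \<in> carrier R" using assms by simp
  have e: "(a \<odot>\<^bsub>R\<^esub> \<one>\<^bsub>R\<^esub>) \<otimes>\<^bsub>R\<^esub> z = a \<odot>\<^bsub>R\<^esub> z" if "z \<in> carrier R" for z
    using assms that smult_assoc2[of a "\<one>\<^bsub>R\<^esub>" z] by simp
  have "x \<otimes>\<^bsub>R\<^esub> (a \<odot>\<^bsub>R\<^esub> y) = (x \<otimes>\<^bsub>R\<^esub> (a \<odot>\<^bsub>R\<^esub> \<one>\<^bsub>R\<^esub>)) \<otimes>\<^bsub>R\<^esub> y"
    using assms c e[of y] by (simp add: A.m_assoc)
  also have "\<dots> = (a \<odot>\<^bsub>R\<^esub> \<one>\<^bsub>R\<^esub>) \<otimes>\<^bsub>R\<^esub> (x \<otimes>\<^bsub>R\<^esub> y)"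
    using assms c scalars_central[of a x] by (simp add: A.m_assoc[symmetric])
  also have "\<dots> = a \<odot>\<^bsub>R\<^esub> (x \<otimes>\<^bsub>R\<^esub> y)" using assms e by simp
  finally show ?thesis .
qed

lemma (in central_algebra) left_mult_in_End_alg:
  assumes "x \<in> carrier R"
  shows "left_mult R x \<in> carrier (End_alg k R)"
proof -
  show ?thesis
    using assms by (simp add: End_alg_def left_mult_def A.r_distr smult_assoc3)
qed

lemma (in central_algebra) End_alg_ring: "ring (End_alg k R)"
proof -
  let ?E = "End_alg k R"
  have lin: "f (x \<oplus>\<^bsub>R\<^esub> y) = f x \<oplus>\<^bsub>R\<^esub> f y" "f x \<in> carrier R"
    if "f \<in> carrier ?E" "x \<in> carrier R" "y \<in> carrier R" for f x y
    using that by (auto simp: End_alg_def)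
  have linZ: "f \<zero>\<^bsub>R\<^esub> = \<zero>\<^bsub>R\<^esub>" if "f \<in> carrier ?E" for f
    using lin[OF that, of "\<zero>\<^bsub>R\<^esub>" "\<zero>\<^bsub>R\<^esub>"] by (metis A.add.r_cancel_one A.l_zero A.zero_closed)
  have ext: "f = g" if "f \<in> carrier ?E" "g \<in> carrier ?E" "\<And>x. x \<in> carrier R \<Longrightarrow> f x = g x" for f g
    using that by (auto simp: End_alg_def intro: PiE_ext)
  have addc: "f \<oplus>\<^bsub>?E\<^esub> g \<in> carrier ?E" if "f \<in> carrier ?E" "g \<in> carrier ?E" for f g
    using that by (auto simp: End_alg_def PiE_iff A.a_ac smult_r_distr)
  have multc: "f \<otimes>\<^bsub>?E\<^esub> g \<in> carrier ?E" if "f \<in> carrier ?E" "g \<in> carrier ?E" for f g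
    using that by (auto simp: End_alg_def PiE_iff compose_def)
  have zc: "\<zero>\<^bsub>?E\<^esub> \<in> carrier ?E" and oc: "\<one>\<^bsub>?E\<^esub> \<in> carrier ?E"
    by (auto simp: End_alg_def)
  have negc: "(\<lambda>x\<in>carrier R. \<ominus>\<^bsub>R\<^esub> f x) \<in> carrier ?E" if "f \<in> carrier ?E" for f
    using that by (auto simp: End_alg_def PiE_iff A.minus_add smult_r_minus)
  have app: "(f \<oplus>\<^bsub>?E\<^esub> g) x = f x \<oplus>\<^bsub>R\<^esub> g x" "(f \<otimes>\<^bsub>?E\<^esub> g) x = f (g x)"
      "\<zero>\<^bsub>?E\<^esub> x = \<zero>\<^bsub>R\<^esub>" "\<one>\<^bsub>?E\<^esub> x = x" if "x \<in> carrier R" for f g x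
    using that by (simp_all add: End_alg_def compose_def)
  show ?thesis
  proof (rule ringI)
    show "abelian_group ?E"
    proof (rule abelian_groupI)
      fix f assume f: "f \<in> carrier ?E"
      show "\<exists>g\<in>carrier ?E. g \<oplus>\<^bsub>?E\<^esub> f = \<zero>\<^bsub>?E\<^esub>"
      proof (intro bexI[OF _ negc[OF f]] ext addc negc zc f)
        fix x assume "x \<in> carrier R"
        then show "((\<lambda>x\<in>carrier R. \<ominus>\<^bsub>R\<^esub> f x) \<oplus>\<^bsub>?E\<^esub> f) x = \<zero>\<^bsub>?E\<^esub> x"
          using lin(2)[OF f] by (simp add: app A.l_neg)
      qed
    qed (auto intro!: ext simp: addc zc app lin(2) A.a_ac)
    show "monoid ?E"
      by (rule monoidI) (auto intro!: ext simp: multc oc app lin(2))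
  qed (auto intro!: ext simp: addc multc app lin)
qed

lemma (in differential_algebra) diff_op_algebra_nontrivial_ring:
  "nontrivial_ring (diff_op_algebra k R \<delta>)"
proof -
  interpret E: ring "End_alg k R" by (rule End_alg_ring)
  let ?E = "End_alg k R"
  let ?X = "insert \<delta> (left_mult R ` carrier R)"
  let ?S = "{S. subring S ?E \<and> submodule S k ?E \<and> ?X \<subseteq> S}"
  have sm: "submodule (carrier ?E) k ?E"
  proof (intro submodule.intro submodule_axioms.intro)
    show "subgroup (carrier ?E) (add_monoid ?E)"
      using E.add.subgroup_self by simp
    fix a f assume af: "a \<in> carrier k" "f \<in> carrier ?E"
    have "b \<odot>\<^bsub>R\<^esub> (a \<odot>\<^bsub>R\<^esub> f x) = a \<odot>\<^bsub>R\<^esub> (b \<odot>\<^bsub>R\<^esub> f x)"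
      if "b \<in> carrier k" "f x \<in> carrier R" for b x
      using that af(1) smult_assoc1[of a b "f x"] smult_assoc1[of b a "f x"]
      by (simp add: K.m_comm)
    then show "a \<odot>\<^bsub>?E\<^esub> f \<in> carrier ?E"
      using af by (auto simp: End_alg_def PiE_iff smult_r_distr)
  qed
  have "carrier ?E \<in> ?S"
    using E.carrier_is_subring sm deriv_linear left_mult_in_End_alg by auto
  then have "subring (\<Inter>?S) ?E"
    by (intro E.subring_Inter) auto
  then have "ring (diff_op_algebra k R \<delta>)"
    unfolding diff_op_algebra_def generated_subalgebra_def by (rule E.subring_is_ring)
  moreover have "\<one>\<^bsub>?E\<^esub> \<noteq> \<zero>\<^bsub>?E\<^esub>"
  proof
    assume "\<one>\<^bsub>?E\<^esub> = \<zero>\<^bsub>?E\<^esub>"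
    then have "\<one>\<^bsub>?E\<^esub> \<one>\<^bsub>R\<^esub> = \<zero>\<^bsub>?E\<^esub> \<one>\<^bsub>R\<^esub>" by simp
    then show False using A.one_not_zero by (simp add: End_alg_def)
  qed
  ultimately show ?thesis
    by (simp add: nontrivial_ring_def nontrivial_ring_axioms_def diff_op_algebra_def)
qed

end

theory Submission
  imports Defs
begin

text \<open>
  Write \<open>D\<close> for \<open>R[\<delta>]\<close>. Everything rests on evaluating a decomposition
  \<open>1 = M b + c M\<close> in \<open>D\<close> at an element \<open>r\<close> of \<open>R\<close> that \<open>M\<close> annihilates: the second summand
  disappears, and \<open>r = M (b r)\<close> lies in the range of \<open>M\<close>. If \<open>M = L N\<close>, then \<open>r\<close> even lies in the
  range of \<open>L\<close> (\<open>annihilated_in_range\<close>). So \<open>L\<close> is surjective as soon as every \<open>r\<close> is annihilated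
  by some \<open>N\<close> with \<open>L N \<noteq> 0\<close>. Since weakly fadelian rings have no zero divisors
  (\<open>no_zero_divisors\<close>), it is enough that \<open>L\<close> and \<open>N\<close> are nonzero.

  A derivation kills \<open>1\<close>, so \<open>N = \<delta>\<close> shows that every nonzero operator attains the value \<open>1\<close>
  (\<open>one_in_range\<close>). For a left multiplication this says that nonzero elements of \<open>R\<close> have right
  inverses, and \<open>R\<close> is a division ring. Now an arbitrary \<open>r \<noteq> 0\<close> is killed by
  \<open>N = \<delta> r\<inverse>\<close>, and every nonzero operator is surjective.

  To pass from weakly fadelian to fadelian, the left Ore condition suffices
  (\<open>fadelian_if_left_Ore\<close>): if \<open>p x = q l\<close> with \<open>p \<noteq> 0\<close>, then multiplying
  \<open>1 = (l p) b + c (l p)\<close> by \<open>x\<close> gives \<open>x = l (p b x) + (c l q) l\<close>. As \<open>R\<close> is a division ring,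
  every operator is a left \<open>R\<close>-combination of powers of \<open>\<delta>\<close>, division with remainder is
  available, and the Ore condition follows as in a Euclidean ring (\<open>left_Ore\<close>). The powers of \<open>\<delta>\<close> are
  treated as generators only, with possible relations between them.
\<close>

section \<open>Weakly fadelian rings\<close>

context weakly_fadelian
begin

text \<open>
  The Peirce corner at \<open>1 - e\<close> sees nothing of \<open>e b + c e\<close>, so it is zero.
\<close>

lemma idempotent_eq_one:
  assumes e: "e \<in> carrier A" and idem: "e \<otimes> e = e" and nz: "e \<noteq> \<zero>"
  shows "e = \<one>"
proof -
  obtain b c where bc: "b \<in> carrier A" "c \<in> carrier A" and dec: "\<one> = e \<otimes> b \<oplus> c \<otimes> e"
    using one_decomp[OF e nz] by blast
  define f where "f = \<one> \<ominus> e"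
  have f: "f \<in> carrier A" and fe: "f \<otimes> e = \<zero>" and ef: "e \<otimes> f = \<zero>" and ff: "f \<otimes> f = f"
    using e idem by (simp_all add: f_def minus_eq l_distr r_distr l_minus r_minus r_neg minus_add)
  have "f = f \<otimes> \<one> \<otimes> f"
    using f ff by simp
  also have "\<dots> = f \<otimes> (e \<otimes> b \<oplus> c \<otimes> e) \<otimes> f"
    using dec by simp
  also have "\<dots> = (f \<otimes> e) \<otimes> b \<otimes> f \<oplus> f \<otimes> c \<otimes> (e \<otimes> f)"
    using f e bc by (simp add: l_distr r_distr m_assoc)
  also have "\<dots> = \<zero>"
    using f bc by (simp add: fe ef)
  finally show ?thesis
    using e f_def by (metis one_closed r_right_minus_eq)
qed

text \<open>
  If \<open>a\<^sup>2 = 0\<close> and \<open>1 = a b + c a\<close>, then \<open>a = a c a\<close>, so \<open>c a\<close> is an idempotent. If \<open>a\<close> were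
  nonzero, then \<open>c a = 1\<close>, and so \<open>a = c a\<^sup>2 = 0\<close>.
\<close>

lemma square_zero_imp_zero:
  assumes a: "a \<in> carrier A" and sq: "a \<otimes> a = \<zero>"
  shows "a = \<zero>"
proof (rule ccontr)
  assume nz: "a \<noteq> \<zero>"
  obtain b c where bc: "b \<in> carrier A" "c \<in> carrier A" and dec: "\<one> = a \<otimes> b \<oplus> c \<otimes> a"
    using one_decomp[OF a nz] by blast
  have "a = a \<otimes> (a \<otimes> b \<oplus> c \<otimes> a)"
    using a by (simp add: dec[symmetric])
  also have "\<dots> = (a \<otimes> a) \<otimes> b \<oplus> a \<otimes> (c \<otimes> a)"
    using a bc by (simp add: r_distr m_assoc)
  finally have aca: "a \<otimes> (c \<otimes> a) = a"
    using a bc by (simp add: sq)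
  have "c \<otimes> a = \<one>"
  proof (rule idempotent_eq_one)
    show "c \<otimes> a \<otimes> (c \<otimes> a) = c \<otimes> a"
      using a bc aca by (simp add: m_assoc)
    show "c \<otimes> a \<noteq> \<zero>"
      using a nz aca by auto
  qed (use a bc in simp)
  then have "a = c \<otimes> (a \<otimes> a)"
    using a bc by (simp add: m_assoc[symmetric])
  with nz bc show False
    by (simp add: sq)
qed

text \<open>
  In a reduced ring, \<open>x y = 0\<close> forces \<open>y x = 0\<close>. Then \<open>y\<close> kills \<open>x\<close> on both sides, and so
  \<open>y\<^sup>2 = y (x b + c x) y = 0\<close>.
\<close>

lemma no_zero_divisors:
  assumes x: "x \<in> carrier A" and y: "y \<in> carrier A" and xy: "x \<otimes> y = \<zero>"
  shows "x = \<zero> \<or> y = \<zero>"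
proof (rule disjCI)
  assume "y \<noteq> \<zero>"
  show "x = \<zero>"
  proof (rule ccontr)
    assume "x \<noteq> \<zero>"
    have "y \<otimes> x \<otimes> (y \<otimes> x) = y \<otimes> (x \<otimes> y) \<otimes> x"
      using x y by (simp add: m_assoc)
    then have "y \<otimes> x \<otimes> (y \<otimes> x) = \<zero>"
      using x y by (simp add: xy)
    then have yx: "y \<otimes> x = \<zero>"
      using square_zero_imp_zero[of "y \<otimes> x"] x y by simp
    obtain b c where bc: "b \<in> carrier A" "c \<in> carrier A" and dec: "\<one> = x \<otimes> b \<oplus> c \<otimes> x"
      using one_decomp[OF x \<open>x \<noteq> \<zero>\<close>] by blast
    have "y \<otimes> y = y \<otimes> (x \<otimes> b \<oplus> c \<otimes> x) \<otimes> y"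
      using y by (simp add: dec[symmetric])
    also have "\<dots> = (y \<otimes> x) \<otimes> b \<otimes> y \<oplus> y \<otimes> c \<otimes> (x \<otimes> y)"
      using x y bc by (simp add: l_distr r_distr m_assoc)
    also have "\<dots> = \<zero>"
      using y bc by (simp add: xy yx)
    finally show False
      using square_zero_imp_zero[OF y] \<open>y \<noteq> \<zero>\<close> by simp
  qed
qed

text \<open>
  Decomposing \<open>1\<close> along \<open>l p\<close> rather than \<open>l\<close> makes \<open>l p x = l q l\<close> end in \<open>l\<close> on the right.
\<close>

lemma fadelian_if_left_Ore:
  assumes Ore: "\<And>x l. \<lbrakk>x \<in> carrier A; l \<in> carrier A; l \<noteq> \<zero>\<rbrakk> \<Longrightarrow>
    \<exists>p \<in> carrier A. \<exists>q \<in> carrier A. p \<noteq> \<zero> \<and> p \<otimes> x = q \<otimes> l"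
  shows "fadelian A"
proof
  fix x l assume x: "x \<in> carrier A" and l: "l \<in> carrier A" "l \<noteq> \<zero>"
  obtain p q where pq: "p \<in> carrier A" "q \<in> carrier A" "p \<noteq> \<zero>" and eq: "p \<otimes> x = q \<otimes> l"
    using Ore[OF x l] by blast
  have "l \<otimes> p \<noteq> \<zero>"
    using no_zero_divisors l pq by blast
  then obtain b c where bc: "b \<in> carrier A" "c \<in> carrier A"
    and dec: "\<one> = l \<otimes> p \<otimes> b \<oplus> c \<otimes> (l \<otimes> p)"
    using one_decomp[of "l \<otimes> p"] l pq by auto
  have "x = (l \<otimes> p \<otimes> b \<oplus> c \<otimes> (l \<otimes> p)) \<otimes> x"
    using x by (simp add: dec[symmetric])
  also have "\<dots> = l \<otimes> (p \<otimes> b \<otimes> x) \<oplus> c \<otimes> l \<otimes> (p \<otimes> x)"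
    using x l pq bc by (simp add: l_distr m_assoc)
  also have "\<dots> = l \<otimes> (p \<otimes> b \<otimes> x) \<oplus> (c \<otimes> l \<otimes> q) \<otimes> l"
    using l pq bc by (simp add: eq m_assoc)
  finally show "\<exists>b\<in>carrier A. \<exists>c\<in>carrier A. x = l \<otimes> b \<oplus> c \<otimes> l"
    using x l pq bc by blast
qed

end


section \<open>The Ore condition for quotients of skew polynomial rings\<close>

text \<open>
  These are the rings without zero divisors that are homomorphic images of Ore extensions of a
  division ring \<open>F\<close>: \<open>d a - a d\<close> stays in \<open>F\<close>, and \<open>F\<close> and \<open>d\<close> generate \<open>A\<close>.
  Generation is expressed as an induction principle: \<open>A\<close> has no proper additive subgroup that
  contains \<open>1\<close> and is stable under left multiplication by \<open>F\<close> and by \<open>d\<close>.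
\<close>

locale skew_polynomial_type = nontrivial_ring A for A (structure) +
  fixes F :: "'a set" and d :: 'a
  assumes no_zero_div:
      "\<lbrakk>x \<in> carrier A; y \<in> carrier A; x \<otimes> y = \<zero>\<rbrakk> \<Longrightarrow> x = \<zero> \<or> y = \<zero>"
    and F_subring: "subring F A"
    and F_inverse: "\<lbrakk>a \<in> F; a \<noteq> \<zero>\<rbrakk> \<Longrightarrow> \<exists>b \<in> F. b \<otimes> a = \<one>"
    and d_closed: "d \<in> carrier A"
    and d_commute: "a \<in> F \<Longrightarrow> \<exists>b \<in> F. d \<otimes> a = b \<oplus> a \<otimes> d"
    and left_generated:
      "\<lbrakk>subgroup V (add_monoid A); \<one> \<in> V;
        \<And>a v. \<lbrakk>a \<in> F; v \<in> V\<rbrakk> \<Longrightarrow> a \<otimes> v \<in> V; \<And>v. v \<in> V \<Longrightarrow> d \<otimes> v \<in> V\<rbrakk>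
        \<Longrightarrow> carrier A \<subseteq> V"
begin

text \<open>
  An element may have several expressions as a polynomial in \<open>d\<close>; these sets record only that one of
  degree less than \<open>n\<close> exists.
\<close>

primrec degree_less :: "nat \<Rightarrow> 'a set" where
  "degree_less 0 = {\<zero>}"
| "degree_less (Suc n) = {m \<oplus> a \<otimes> d [^] n |m a. m \<in> degree_less n \<and> a \<in> F}"

lemma F_in_carrier: "a \<in> F \<Longrightarrow> a \<in> carrier A"
  using F_subring subringE(1) by blast

lemmas F_closed = subringE(2,3,5,6,7)[OF F_subring]

lemma degree_less_closed: "m \<in> degree_less n \<Longrightarrow> m \<in> carrier A"
  by (induction n arbitrary: m) (auto simp: F_in_carrier d_closed)

lemma degree_less_SucI: "\<lbrakk>m \<in> degree_less n; a \<in> F\<rbrakk> \<Longrightarrow> m \<oplus> a \<otimes> d [^] n \<in> degree_less (Suc n)"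
  by auto

lemma degree_less_mono_Suc: "m \<in> degree_less n \<Longrightarrow> m \<in> degree_less (Suc n)"
  using degree_less_SucI[of m n \<zero>] F_closed(1) d_closed degree_less_closed[of m n]
  by (simp del: degree_less.simps)

lemma zero_in_degree_less: "\<zero> \<in> degree_less n"
  by (induction n) (simp, rule degree_less_mono_Suc)

lemma one_in_degree_less: "\<one> \<in> degree_less (Suc n)"
proof (induction n)
  case 0
  show ?case using degree_less_SucI[of \<zero> 0 \<one>] F_closed(2) by simp
next
  case (Suc n)
  then show ?case by (rule degree_less_mono_Suc)
qed

lemma degree_less_add: "\<lbrakk>x \<in> degree_less n; y \<in> degree_less n\<rbrakk> \<Longrightarrow> x \<oplus> y \<in> degree_less n"
proof (induction n arbitrary: x y)
  case (Suc n)
  then obtain m a m' a' where xy: "x = m \<oplus> a \<otimes> d [^] n" "y = m' \<oplus> a' \<otimes> d [^] n"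
    and m: "m \<in> degree_less n" "m' \<in> degree_less n" and a: "a \<in> F" "a' \<in> F"
    by auto
  have eq: "x \<oplus> y = (m \<oplus> m') \<oplus> (a \<oplus> a') \<otimes> d [^] n"
    using m a d_closed by (simp add: xy degree_less_closed F_in_carrier l_distr a_ac)
  then show ?case
    unfolding eq by (intro degree_less_SucI Suc.IH F_closed m a)
qed simp

lemma degree_less_lmult: "\<lbrakk>b \<in> F; x \<in> degree_less n\<rbrakk> \<Longrightarrow> b \<otimes> x \<in> degree_less n"
proof (induction n arbitrary: x)
  case 0
  then show ?case by (simp add: F_in_carrier)
next
  case (Suc n)
  then obtain m a where x: "x = m \<oplus> a \<otimes> d [^] n"
    and m: "m \<in> degree_less n" and a: "a \<in> F"
    by auto
  have eq: "b \<otimes> x = b \<otimes> m \<oplus> (b \<otimes> a) \<otimes> d [^] n"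
    using m a \<open>b \<in> F\<close> d_closed
    by (simp add: x degree_less_closed F_in_carrier r_distr m_assoc)
  then show ?case
    unfolding eq by (intro degree_less_SucI Suc.IH F_closed m a \<open>b \<in> F\<close>)
qed

text \<open>
  The rule \<open>d a = b + a d\<close> moves coefficients back to the left: the term \<open>a d\<^sup>n\<close> becomes
  \<open>b d\<^sup>n + a d\<^sup>n\<^sup>+\<^sup>1\<close>.
\<close>

lemma d_mult_degree_less: "x \<in> degree_less n \<Longrightarrow> d \<otimes> x \<in> degree_less (Suc n)"
proof (induction n arbitrary: x)
  case 0
  then show ?case using zero_in_degree_less[of "Suc 0"] d_closed by simp
next
  case (Suc n)
  then obtain m a where x: "x = m \<oplus> a \<otimes> d [^] n"
    and m: "m \<in> degree_less n" and a: "a \<in> F"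
    by auto
  obtain b where b: "b \<in> F" and da: "d \<otimes> a = b \<oplus> a \<otimes> d"
    using d_commute[OF a] by blast
  note cl = m a b d_closed degree_less_closed F_in_carrier
  have "d \<otimes> x = d \<otimes> m \<oplus> (d \<otimes> a) \<otimes> d [^] n"
    using cl by (simp add: x r_distr m_assoc)
  also have "\<dots> = (d \<otimes> m \<oplus> b \<otimes> d [^] n) \<oplus> a \<otimes> (d \<otimes> d [^] n)"
    using cl by (simp add: da l_distr m_assoc a_assoc)
  also have "d \<otimes> d [^] n = d [^] Suc n"
    using d_closed by (metis nat_pow_Suc2)
  finally have eq: "d \<otimes> x = (d \<otimes> m \<oplus> b \<otimes> d [^] n) \<oplus> a \<otimes> d [^] Suc n" .
  have "\<zero> \<oplus> b \<otimes> d [^] n \<in> degree_less (Suc n)"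
    using zero_in_degree_less b by auto
  then have "b \<otimes> d [^] n \<in> degree_less (Suc n)"
    using cl by simp
  then have "d \<otimes> m \<oplus> b \<otimes> d [^] n \<in> degree_less (Suc n)"
    using degree_less_add Suc.IH[OF m] by blast
  then show ?case
    unfolding eq degree_less.simps(2)[of "Suc n"] using a by blast
qed

lemma add_subgroupI:
  assumes "V \<subseteq> carrier A" "\<one> \<in> V"
    and add: "\<And>v w. \<lbrakk>v \<in> V; w \<in> V\<rbrakk> \<Longrightarrow> v \<oplus> w \<in> V"
    and lmult: "\<And>a v. \<lbrakk>a \<in> F; v \<in> V\<rbrakk> \<Longrightarrow> a \<otimes> v \<in> V"
  shows "subgroup V (add_monoid A)"
proof (rule add.subgroupI)
  fix v assume v: "v \<in> V"
  have "(\<ominus> \<one>) \<otimes> v \<in> V"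
    using lmult v F_closed by blast
  then show "\<ominus> v \<in> V"
    using v assms(1) by (simp add: l_minus subset_iff)
qed (use assms in auto)

lemma has_degree:
  assumes "x \<in> carrier A"
  shows "\<exists>n. x \<in> degree_less n"
proof -
  let ?V = "\<Union>n. degree_less n"
  have mono: "m \<in> degree_less n'" if "m \<in> degree_less n" "n \<le> n'" for m n n'
    using that(2,1) by (induction rule: dec_induct) (auto intro: degree_less_mono_Suc simp del: degree_less.simps)
  have add: "v \<oplus> w \<in> ?V" if vw: "v \<in> ?V" "w \<in> ?V" for v w
  proof -
    obtain i j where "v \<in> degree_less i" "w \<in> degree_less j"
      using vw by blast
    then have "v \<in> degree_less (max i j)" "w \<in> degree_less (max i j)"
      by (auto intro: mono)
    then show ?thesis
      using degree_less_add by blast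
  qed
  have Vc: "?V \<subseteq> carrier A"
    using degree_less_closed by blast
  have one: "\<one> \<in> ?V"
    using one_in_degree_less by blast
  have lm: "a \<otimes> v \<in> ?V" if "a \<in> F" "v \<in> ?V" for a v
    using that degree_less_lmult by blast
  have dm: "d \<otimes> v \<in> ?V" if "v \<in> ?V" for v
    using that d_mult_degree_less by blast
  have "carrier A \<subseteq> ?V"
    by (rule left_generated[OF add_subgroupI[OF Vc one add lm] one lm dm])
  with assms show ?thesis by blast
qed

text \<open>
  Modulo the left ideal \<open>A l\<close>, the leading coefficient of \<open>l\<close> being invertible, \<open>d\<^sup>n\<close> is equal to a
  polynomial of degree less than \<open>n\<close>. Hence \<open>A l\<close> plus the elements of degree less than \<open>n\<close> is
  stable under \<open>d\<close>, and by generation it is everything.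
\<close>

lemma left_division:
  assumes l: "l = m \<oplus> a \<otimes> d [^] n" and m: "m \<in> degree_less n"
    and a: "a \<in> F" "a \<noteq> \<zero>" and x: "x \<in> carrier A"
  shows "\<exists>q \<in> carrier A. \<exists>s \<in> degree_less n. x = q \<otimes> l \<oplus> s"
proof -
  let ?V = "{q \<otimes> l \<oplus> s |q s. q \<in> carrier A \<and> s \<in> degree_less n}"
  note cl = d_closed degree_less_closed F_in_carrier
  have lc: "l \<in> carrier A"
    using l m a cl by simp
  have Vc: "?V \<subseteq> carrier A"
    using lc cl by auto
  have low: "s \<in> ?V" if "s \<in> degree_less n" for s
  proof -
    have "s = \<zero> \<otimes> l \<oplus> s" using that lc cl by simp
    then show ?thesis using that by blast
  qed
  have mult: "q \<otimes> l \<in> ?V" if "q \<in> carrier A" for q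
  proof -
    have "q \<otimes> l = q \<otimes> l \<oplus> \<zero>" using that lc by simp
    then show ?thesis using that zero_in_degree_less by blast
  qed
  have add: "v \<oplus> w \<in> ?V" if "v \<in> ?V" "w \<in> ?V" for v w
  proof -
    from that obtain q s q' s' where v: "v = q \<otimes> l \<oplus> s" and w: "w = q' \<otimes> l \<oplus> s'"
      and qs: "q \<in> carrier A" "q' \<in> carrier A" "s \<in> degree_less n" "s' \<in> degree_less n"
      by blast
    have "v \<oplus> w = (q \<oplus> q') \<otimes> l \<oplus> (s \<oplus> s')"
      using v w qs lc cl by (simp add: l_distr a_ac)
    then show ?thesis using qs degree_less_add by blast
  qed
  have lm: "b \<otimes> v \<in> ?V" if b: "b \<in> F" and v: "v \<in> ?V" for b v
  proof -
    from v obtain q s where v: "v = q \<otimes> l \<oplus> s" and qs: "q \<in> carrier A" "s \<in> degree_less n"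
      by blast
    have "b \<otimes> v = (b \<otimes> q) \<otimes> l \<oplus> b \<otimes> s"
      using v qs lc cl b by (simp add: r_distr m_assoc)
    moreover have "b \<otimes> q \<in> carrier A" "b \<otimes> s \<in> degree_less n"
      using qs b F_in_carrier degree_less_lmult by simp_all
    ultimately show ?thesis by blast
  qed
  have pow: "d [^] n \<in> ?V"
  proof -
    obtain b where b: "b \<in> F" "b \<otimes> a = \<one>"
      using F_inverse a by blast
    have "b \<otimes> l = b \<otimes> m \<oplus> (b \<otimes> a) \<otimes> d [^] n"
      using m a b(1) cl by (simp add: l r_distr m_assoc)
    also have "\<dots> = d [^] n \<oplus> b \<otimes> m"
      using m b cl by (simp add: a_comm)
    finally have "b \<otimes> l = d [^] n \<oplus> b \<otimes> m" .
    then have "d [^] n = b \<otimes> l \<oplus> (\<ominus> \<one>) \<otimes> (b \<otimes> m)"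
      using m b cl by (simp add: l_minus a_assoc r_neg)
    moreover have "(\<ominus> \<one>) \<otimes> (b \<otimes> m) \<in> degree_less n"
      by (intro degree_less_lmult[OF F_closed(3)[OF F_closed(2)] degree_less_lmult] b m)
    ultimately show ?thesis using F_in_carrier[OF b(1)] by blast
  qed
  have dm: "d \<otimes> v \<in> ?V" if "v \<in> ?V" for v
  proof -
    from that obtain q s where v: "v = q \<otimes> l \<oplus> s" and qs: "q \<in> carrier A" "s \<in> degree_less n"
      by blast
    have "d \<otimes> s \<in> degree_less (Suc n)"
      using qs d_mult_degree_less by blast
    then obtain s' b where ds: "d \<otimes> s = s' \<oplus> b \<otimes> d [^] n" "s' \<in> degree_less n" "b \<in> F"
      by auto
    have "d \<otimes> v = (d \<otimes> q) \<otimes> l \<oplus> d \<otimes> s"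
      using v qs lc cl by (simp add: r_distr m_assoc)
    moreover have "d \<otimes> s \<in> ?V"
      unfolding ds(1) by (rule add[OF low[OF ds(2)] lm[OF ds(3) pow]])
    ultimately show ?thesis
      using add[OF mult[of "d \<otimes> q"]] qs d_closed by simp
  qed
  have one: "\<one> \<in> ?V"
    \<comment> \<open>In degree 0, where no remainders are available, \<open>d\<^sup>n\<close> is \<open>1\<close> itself.\<close>
  proof (cases n)
    case 0
    then show ?thesis using pow by simp
  next
    case (Suc n')
    show ?thesis using one_in_degree_less[of n'] unfolding Suc[symmetric] by (rule low)
  qed
  have "carrier A \<subseteq> ?V"
    by (rule left_generated[OF add_subgroupI[OF Vc one add lm] one lm dm])
  with x show ?thesis by blast
qed

text \<open>
  Induction on the degree of \<open>l\<close>. Divide, \<open>x = q l + s\<close>. If \<open>s \<noteq> 0\<close>, apply the induction hypothesis to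
  the remainder \<open>s\<close> and to \<open>l\<close> in the role of \<open>x\<close>: it gives \<open>p l = r s\<close> with \<open>p \<noteq> 0\<close>. Then
  \<open>r x = (r q + p) l\<close>, and \<open>r \<noteq> 0\<close> because \<open>r s = p l \<noteq> 0\<close>.
\<close>

lemma left_Ore:
  assumes "x \<in> carrier A" "l \<in> carrier A" "l \<noteq> \<zero>"
  shows "\<exists>p \<in> carrier A. \<exists>q \<in> carrier A. p \<noteq> \<zero> \<and> p \<otimes> x = q \<otimes> l"
proof -
  have "\<exists>p \<in> carrier A. \<exists>q \<in> carrier A. p \<noteq> \<zero> \<and> p \<otimes> x = q \<otimes> l"
    if "l \<in> degree_less n" "l \<noteq> \<zero>" "x \<in> carrier A" for n x l
    using that
  proof (induction n arbitrary: x l)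
    case 0
    then show ?case by simp
  next
    case (Suc n)
    then obtain m a where l: "l = m \<oplus> a \<otimes> d [^] n" and m: "m \<in> degree_less n" and a: "a \<in> F"
      by auto
    have lc: "l \<in> carrier A"
      using Suc.prems(1) by (rule degree_less_closed)
    show ?case
    proof (cases "a = \<zero>")
      case True
      then have "l \<in> degree_less n"
        using l m d_closed degree_less_closed by simp
      then show ?thesis using Suc.IH Suc.prems by blast
    next
      case False
      obtain q s where q: "q \<in> carrier A" and s: "s \<in> degree_less n" and x: "x = q \<otimes> l \<oplus> s"
        using left_division[OF l m a False Suc.prems(3)] by blast
      have sc: "s \<in> carrier A" using s by (rule degree_less_closed)
      show ?thesis
      proof (cases "s = \<zero>")
        case True
        then have "\<one> \<otimes> x = q \<otimes> l" using x q lc by simp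
        then show ?thesis using q one_not_zero by blast
      next
        case False
        obtain p r where pr: "p \<in> carrier A" "r \<in> carrier A" "p \<noteq> \<zero>" and eq: "p \<otimes> l = r \<otimes> s"
          using Suc.IH[OF s False lc] by blast
        have "p \<otimes> l \<noteq> \<zero>"
          using no_zero_div pr lc Suc.prems(2) by blast
        then have "r \<noteq> \<zero>"
          using eq sc by auto
        moreover have "r \<otimes> x = (r \<otimes> q \<oplus> p) \<otimes> l"
          using x pr q lc sc eq by (simp add: l_distr r_distr m_assoc)
        ultimately show ?thesis using pr q by blast
      qed
    qed
  qed
  then show ?thesis
    using assms has_degree by blast
qed

end


section \<open>The algebra of differential operators\<close>

context differential_algebra
begin

abbreviation E where "E \<equiv> End_alg k R"
abbreviation D where "D \<equiv> diff_op_algebra k R \<delta>"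

lemma End_closed: "\<lbrakk>f \<in> carrier E; x \<in> carrier R\<rbrakk> \<Longrightarrow> f x \<in> carrier R"
  by (auto simp: End_alg_def)

lemma End_add: "\<lbrakk>f \<in> carrier E; x \<in> carrier R; y \<in> carrier R\<rbrakk> \<Longrightarrow> f (x \<oplus>\<^bsub>R\<^esub> y) = f x \<oplus>\<^bsub>R\<^esub> f y"
  by (auto simp: End_alg_def)

lemma End_ext:
  "\<lbrakk>f \<in> carrier E; g \<in> carrier E; \<And>x. x \<in> carrier R \<Longrightarrow> f x = g x\<rbrakk> \<Longrightarrow> f = g"
  by (auto simp: End_alg_def intro: PiE_ext)

lemma End_zero:
  assumes "f \<in> carrier E" shows "f \<zero>\<^bsub>R\<^esub> = \<zero>\<^bsub>R\<^esub>"
  using assms End_add[of f "\<zero>\<^bsub>R\<^esub>" "\<zero>\<^bsub>R\<^esub>"] End_closed[of f "\<zero>\<^bsub>R\<^esub>"]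
  by (metis A.add.r_cancel_one A.l_zero A.zero_closed)

lemma End_apply:
  assumes "x \<in> carrier R"
  shows "(f \<oplus>\<^bsub>E\<^esub> g) x = f x \<oplus>\<^bsub>R\<^esub> g x" "(f \<otimes>\<^bsub>E\<^esub> g) x = f (g x)"
    "\<zero>\<^bsub>E\<^esub> x = \<zero>\<^bsub>R\<^esub>" "\<one>\<^bsub>E\<^esub> x = x" "(c \<odot>\<^bsub>E\<^esub> f) x = c \<odot>\<^bsub>R\<^esub> f x"
  using assms by (simp_all add: End_alg_def compose_def)

lemma left_mult_apply: "y \<in> carrier R \<Longrightarrow> left_mult R x y = x \<otimes>\<^bsub>R\<^esub> y"
  by (simp add: left_mult_def)

lemma End_smult_closed: "\<lbrakk>c \<in> carrier k; f \<in> carrier E\<rbrakk> \<Longrightarrow> c \<odot>\<^bsub>E\<^esub> f \<in> carrier E"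
  by (auto simp: End_alg_def PiE_iff smult_r_distr smult_assoc1[symmetric] K.m_comm)

lemma D_ops: "mult D = mult E" "one D = one E" "zero D = zero E" "add D = add E"
  by (simp_all add: diff_op_algebra_def)

lemma generated_subset:
  assumes "subring S E" "submodule S k E" "\<delta> \<in> S" "\<And>a. a \<in> carrier R \<Longrightarrow> left_mult R a \<in> S"
  shows "carrier D \<subseteq> S"
  using assms by (auto simp: diff_op_algebra_def generated_subalgebra_def)

lemma D_subset_E: "carrier D \<subseteq> carrier E"
proof -
  interpret E: ring E by (rule End_alg_ring)
  show ?thesis
  proof (rule generated_subset)
    show "submodule (carrier E) k E"
      by (intro submodule.intro submodule_axioms.intro)
         (use E.add.subgroup_self End_smult_closed in auto)
  qed (use E.carrier_is_subring deriv_linear left_mult_in_End_alg in auto)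
qed

lemma D_generators: "\<delta> \<in> carrier D" "a \<in> carrier R \<Longrightarrow> left_mult R a \<in> carrier D"
  by (auto simp: diff_op_algebra_def generated_subalgebra_def)

text \<open>
  The operators that map \<open>V\<close> into itself under composition from the left form a subalgebra
  containing the generators, hence all of \<open>D\<close>; apply them to \<open>1 \<in> V\<close>.
\<close>

lemma D_left_generated:
  assumes V: "subgroup V (add_monoid D)" and one: "\<one>\<^bsub>D\<^esub> \<in> V"
    and lm: "\<And>a v. \<lbrakk>a \<in> carrier R; v \<in> V\<rbrakk> \<Longrightarrow> left_mult R a \<otimes>\<^bsub>D\<^esub> v \<in> V"
    and dm: "\<And>v. v \<in> V \<Longrightarrow> \<delta> \<otimes>\<^bsub>D\<^esub> v \<in> V"
  shows "carrier D \<subseteq> V"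
proof -
  interpret E: ring E by (rule End_alg_ring)
  define S where "S = {f \<in> carrier E. \<forall>v \<in> V. f \<otimes>\<^bsub>E\<^esub> v \<in> V}"
  have VE: "v \<in> carrier E" if "v \<in> V" for v
    using that subgroup.subset[OF V] D_subset_E by auto
  have add: "v \<oplus>\<^bsub>E\<^esub> w \<in> V" if "v \<in> V" "w \<in> V" for v w
    using subgroup.m_closed[OF V that] by (simp add: D_ops)
  note lm' = lm[unfolded D_ops]
  \<comment> \<open>Covers negation (\<open>a = -1\<close>) and the action of scalars (\<open>a = c \<cdot> 1\<close>) at once.\<close>
  have scale: "g \<in> S"
    if f: "f \<in> S" and g: "g \<in> carrier E" and a: "a \<in> carrier R"
      and gf: "\<And>x. x \<in> carrier R \<Longrightarrow> g x = a \<otimes>\<^bsub>R\<^esub> f x" for f g a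
  proof -
    have fE: "f \<in> carrier E" using f by (simp add: S_def)
    have "g = left_mult R a \<otimes>\<^bsub>E\<^esub> f"
      by (rule End_ext) (use g a fE left_mult_in_End_alg gf in
          \<open>auto simp: End_apply left_mult_apply End_closed\<close>)
    then show ?thesis
      using f fE g a lm' VE left_mult_in_End_alg by (auto simp: S_def E.m_assoc)
  qed
  have "subring S E"
  proof (rule E.subringI)
    show "\<one>\<^bsub>E\<^esub> \<in> S" using VE by (simp add: S_def)
    fix f assume f: "f \<in> S"
    then have fE: "f \<in> carrier E" by (simp add: S_def)
    show "\<ominus>\<^bsub>E\<^esub> f \<in> S"
    proof (rule scale[OF f, of _ "\<ominus>\<^bsub>R\<^esub> \<one>\<^bsub>R\<^esub>"])
      fix x assume x: "x \<in> carrier R"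
      have "(\<ominus>\<^bsub>E\<^esub> f \<oplus>\<^bsub>E\<^esub> f) x = \<zero>\<^bsub>R\<^esub>"
        using fE x by (simp add: E.l_neg End_apply)
      then have "(\<ominus>\<^bsub>E\<^esub> f) x \<oplus>\<^bsub>R\<^esub> f x = \<zero>\<^bsub>R\<^esub>"
        using x by (simp add: End_apply)
      then have "(\<ominus>\<^bsub>E\<^esub> f) x = \<ominus>\<^bsub>R\<^esub> f x"
        using fE x by (intro A.minus_equality[symmetric]) (simp_all add: End_closed)
      then show "(\<ominus>\<^bsub>E\<^esub> f) x = \<ominus>\<^bsub>R\<^esub> \<one>\<^bsub>R\<^esub> \<otimes>\<^bsub>R\<^esub> f x"
        using fE x by (simp add: End_closed A.l_minus)
    qed (use fE in auto)
    fix g assume g: "g \<in> S"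
    then have gE: "g \<in> carrier E" by (simp add: S_def)
    show "f \<otimes>\<^bsub>E\<^esub> g \<in> S" "f \<oplus>\<^bsub>E\<^esub> g \<in> S"
      using f g fE gE VE add by (auto simp: S_def E.m_assoc E.l_distr)
  qed (auto simp: S_def)
  moreover have "submodule S k E"
  proof (intro submodule.intro submodule_axioms.intro)
    show "subgroup S (add_monoid E)"
      using \<open>subring S E\<close> by (rule subring.axioms)
    fix c f assume c: "c \<in> carrier k" and f: "f \<in> S"
    show "c \<odot>\<^bsub>E\<^esub> f \<in> S"
      by (rule scale[OF f, of _ "c \<odot>\<^bsub>R\<^esub> \<one>\<^bsub>R\<^esub>"])
         (use c f in \<open>auto simp: S_def End_apply End_smult_closed End_closed smult_assoc2\<close>)
  qed
  moreover have "\<delta> \<in> S" using deriv_linear dm by (simp add: S_def D_ops)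
  moreover have "left_mult R a \<in> S" if "a \<in> carrier R" for a
    using that lm' left_mult_in_End_alg by (simp add: S_def)
  ultimately have DS: "carrier D \<subseteq> S"
    by (rule generated_subset)
  show ?thesis
  proof
    fix f assume "f \<in> carrier D"
    then have "f \<in> S" using DS by blast
    then have "f \<otimes>\<^bsub>E\<^esub> \<one>\<^bsub>E\<^esub> \<in> V" "f \<in> carrier E" using one by (auto simp: S_def D_ops)
    then show "f \<in> V" by simp
  qed
qed

lemma deriv_one: "\<delta> \<one>\<^bsub>R\<^esub> = \<zero>\<^bsub>R\<^esub>"
proof -
  have d1: "\<delta> \<one>\<^bsub>R\<^esub> \<in> carrier R" using deriv_linear by (simp add: End_closed)
  have "\<delta> \<one>\<^bsub>R\<^esub> = \<delta> \<one>\<^bsub>R\<^esub> \<oplus>\<^bsub>R\<^esub> \<delta> \<one>\<^bsub>R\<^esub>"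
    using deriv_mult[of "\<one>\<^bsub>R\<^esub>" "\<one>\<^bsub>R\<^esub>"] d1 by simp
  then show ?thesis using d1 by (metis A.add.r_cancel_one)
qed

lemma D_apply:
  assumes "x \<in> carrier R"
  shows "(f \<oplus>\<^bsub>D\<^esub> g) x = f x \<oplus>\<^bsub>R\<^esub> g x" "(f \<otimes>\<^bsub>D\<^esub> g) x = f (g x)"
    "\<zero>\<^bsub>D\<^esub> x = \<zero>\<^bsub>R\<^esub>" "\<one>\<^bsub>D\<^esub> x = x"
  using assms by (simp_all add: D_ops End_apply)

lemmas D_closed = End_closed[OF subsetD[OF D_subset_E]]
lemmas D_zero = End_zero[OF subsetD[OF D_subset_E]]
lemmas D_ext = End_ext[OF subsetD[OF D_subset_E] subsetD[OF D_subset_E]]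

end

section \<open>Ranges of differential operators\<close>

locale weakly_fadelian_differential_algebra = differential_algebra +
  assumes D_weakly_fadelian: "weakly_fadelian (diff_op_algebra k R \<delta>)"
begin

sublocale D: weakly_fadelian D
  by (rule D_weakly_fadelian)

text \<open>
  In \<open>1 = (L N) b + c (L N)\<close> the summand \<open>c (L N)\<close> vanishes at \<open>r\<close>, leaving \<open>r = L (N (b r))\<close>.
\<close>

lemma annihilated_in_range:
  assumes L: "L \<in> carrier D" and N: "N \<in> carrier D" and nz: "L \<otimes>\<^bsub>D\<^esub> N \<noteq> \<zero>\<^bsub>D\<^esub>"
    and r: "r \<in> carrier R" and Nr: "N r = \<zero>\<^bsub>R\<^esub>"
  shows "r \<in> L ` carrier R"
proof -
  obtain b c where bc: "b \<in> carrier D" "c \<in> carrier D"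
    and dec: "\<one>\<^bsub>D\<^esub> = (L \<otimes>\<^bsub>D\<^esub> N) \<otimes>\<^bsub>D\<^esub> b \<oplus>\<^bsub>D\<^esub> c \<otimes>\<^bsub>D\<^esub> (L \<otimes>\<^bsub>D\<^esub> N)"
    using D.one_decomp[of "L \<otimes>\<^bsub>D\<^esub> N"] L N nz by blast
  have "r = ((L \<otimes>\<^bsub>D\<^esub> N) \<otimes>\<^bsub>D\<^esub> b \<oplus>\<^bsub>D\<^esub> c \<otimes>\<^bsub>D\<^esub> (L \<otimes>\<^bsub>D\<^esub> N)) r"
    using r by (simp add: dec[symmetric] D_apply)
  also have "\<dots> = L (N (b r))"
    using r bc L N Nr by (simp add: D_apply D_closed D_zero)
  finally show ?thesis
    using D_closed r bc N by blast
qed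

text \<open>
  The operator \<open>\<delta>\<close> annihilates \<open>1\<close>, and \<open>L \<delta> \<noteq> 0\<close> for lack of zero divisors.
\<close>

lemma one_in_range:
  assumes L: "L \<in> carrier D" "L \<noteq> \<zero>\<^bsub>D\<^esub>"
  shows "\<one>\<^bsub>R\<^esub> \<in> L ` carrier R"
proof (rule annihilated_in_range)
  have "\<delta> \<noteq> \<zero>\<^bsub>D\<^esub>"
    using deriv_nonzero by (simp add: D_ops)
  then show "L \<otimes>\<^bsub>D\<^esub> \<delta> \<noteq> \<zero>\<^bsub>D\<^esub>"
    using D.no_zero_divisors L D_generators(1) by blast
qed (use L D_generators deriv_one in auto)

lemma left_mult_nonzero:
  assumes "x \<in> carrier R" "x \<noteq> \<zero>\<^bsub>R\<^esub>" shows "left_mult R x \<noteq> \<zero>\<^bsub>D\<^esub>"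
proof
  assume "left_mult R x = \<zero>\<^bsub>D\<^esub>"
  then have "left_mult R x \<one>\<^bsub>R\<^esub> = \<zero>\<^bsub>R\<^esub>" by (simp add: D_apply)
  with assms show False by (simp add: left_mult_apply)
qed

lemma right_inverse:
  assumes "x \<in> carrier R" "x \<noteq> \<zero>\<^bsub>R\<^esub>"
  shows "\<exists>y \<in> carrier R. x \<otimes>\<^bsub>R\<^esub> y = \<one>\<^bsub>R\<^esub>"
proof -
  have "\<one>\<^bsub>R\<^esub> \<in> left_mult R x ` carrier R"
    using one_in_range D_generators(2) left_mult_nonzero assms by blast
  then show ?thesis
    by (force simp: left_mult_apply)
qed

text \<open>
  The right inverse \<open>y\<close> of \<open>x\<close> has itself a right inverse, which must then be \<open>x\<close>.
\<close>

lemma inverse: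
  assumes x: "x \<in> carrier R" "x \<noteq> \<zero>\<^bsub>R\<^esub>"
  shows "\<exists>y \<in> carrier R. y \<noteq> \<zero>\<^bsub>R\<^esub> \<and> x \<otimes>\<^bsub>R\<^esub> y = \<one>\<^bsub>R\<^esub> \<and> y \<otimes>\<^bsub>R\<^esub> x = \<one>\<^bsub>R\<^esub>"
proof -
  obtain y where y: "y \<in> carrier R" and xy: "x \<otimes>\<^bsub>R\<^esub> y = \<one>\<^bsub>R\<^esub>"
    using right_inverse x by blast
  have y0: "y \<noteq> \<zero>\<^bsub>R\<^esub>"
    using xy x A.one_not_zero by auto
  obtain z where z: "z \<in> carrier R" and yz: "y \<otimes>\<^bsub>R\<^esub> z = \<one>\<^bsub>R\<^esub>"
    using right_inverse y y0 by blast
  have "y \<otimes>\<^bsub>R\<^esub> x = \<one>\<^bsub>R\<^esub>"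
    using A.inv_unique[OF xy yz] x y z yz by auto
  then show ?thesis using y y0 xy by blast
qed

lemma skew_field: "skew_field R"
proof (intro skew_field.intro skew_field_axioms.intro)
  show "nontrivial_ring R" by unfold_locales
  show "Units R = carrier R - {\<zero>\<^bsub>R\<^esub>}"
    using inverse A.one_not_zero by (auto simp: Units_def)
qed

text \<open>
  The operator \<open>\<delta> r\<inverse>\<close> annihilates \<open>r\<close>, since it sends \<open>r\<close> to \<open>\<delta> 1\<close>.
\<close>

lemma surjective:
  assumes L: "L \<in> carrier D" "L \<noteq> \<zero>\<^bsub>D\<^esub>"
  shows "L ` carrier R = carrier R"
proof
  show "L ` carrier R \<subseteq> carrier R"
    using L D_closed by blast
  show "carrier R \<subseteq> L ` carrier R"
  proof
    fix r assume r: "r \<in> carrier R"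
    show "r \<in> L ` carrier R"
    proof (cases "r = \<zero>\<^bsub>R\<^esub>")
      case True
      have "L \<zero>\<^bsub>R\<^esub> = \<zero>\<^bsub>R\<^esub>" using L D_zero by blast
      then show ?thesis unfolding True by (metis A.zero_closed image_eqI)
    next
      case False
      obtain s where s: "s \<in> carrier R" "s \<noteq> \<zero>\<^bsub>R\<^esub>" and sr: "s \<otimes>\<^bsub>R\<^esub> r = \<one>\<^bsub>R\<^esub>"
        using inverse r False by blast
      show ?thesis
      proof (rule annihilated_in_range)
        let ?N = "\<delta> \<otimes>\<^bsub>D\<^esub> left_mult R s"
        show N: "?N \<in> carrier D"
          using s D_generators by simp
        have "\<delta> \<noteq> \<zero>\<^bsub>D\<^esub>"
          using deriv_nonzero by (simp add: D_ops)
        then have "?N \<noteq> \<zero>\<^bsub>D\<^esub>"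
          using D.no_zero_divisors D_generators left_mult_nonzero s by blast
        then show "L \<otimes>\<^bsub>D\<^esub> ?N \<noteq> \<zero>\<^bsub>D\<^esub>"
          using D.no_zero_divisors L N by blast
        show "?N r = \<zero>\<^bsub>R\<^esub>"
          using r by (simp add: D_apply left_mult_apply sr deriv_one)
      qed (use L r in auto)
    qed
  qed
qed

text \<open>
  The commutation rule is the Leibniz rule read as an identity of operators:
  \<open>\<delta> x = \<delta>(x) + x \<delta>\<close>.
\<close>

sublocale D: skew_polynomial_type D "left_mult R ` carrier R" \<delta>
proof (intro skew_polynomial_type.intro skew_polynomial_type_axioms.intro)
  note lmD = D_generators(2)
  have one: "left_mult R \<one>\<^bsub>R\<^esub> = \<one>\<^bsub>D\<^esub>"
    by (rule D_ext) (auto simp: lmD left_mult_apply D_apply)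
  have mult: "left_mult R x \<otimes>\<^bsub>D\<^esub> left_mult R y = left_mult R (x \<otimes>\<^bsub>R\<^esub> y)"
    if "x \<in> carrier R" "y \<in> carrier R" for x y
    by (rule D_ext) (use that in \<open>auto simp: lmD left_mult_apply D_apply A.m_assoc\<close>)
  have add: "left_mult R x \<oplus>\<^bsub>D\<^esub> left_mult R y = left_mult R (x \<oplus>\<^bsub>R\<^esub> y)"
    if "x \<in> carrier R" "y \<in> carrier R" for x y
    by (rule D_ext) (use that in \<open>auto simp: lmD left_mult_apply D_apply A.l_distr\<close>)
  have zero: "left_mult R \<zero>\<^bsub>R\<^esub> = \<zero>\<^bsub>D\<^esub>"
    by (rule D_ext) (auto simp: lmD left_mult_apply D_apply)
  show "subring (left_mult R ` carrier R) D"
  proof (rule D.subringI)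
    show "\<one>\<^bsub>D\<^esub> \<in> left_mult R ` carrier R"
      by (metis one A.one_closed image_eqI)
    fix f assume f: "f \<in> left_mult R ` carrier R"
    then obtain x where x: "x \<in> carrier R" "f = left_mult R x" by blast
    have "\<ominus>\<^bsub>D\<^esub> f = left_mult R (\<ominus>\<^bsub>R\<^esub> x)"
      using x by (intro D.minus_equality) (simp_all add: add lmD A.l_neg zero)
    then show "\<ominus>\<^bsub>D\<^esub> f \<in> left_mult R ` carrier R"
      using x by simp
    fix g assume g: "g \<in> left_mult R ` carrier R"
    then obtain y where y: "y \<in> carrier R" "g = left_mult R y" by blast
    show "f \<otimes>\<^bsub>D\<^esub> g \<in> left_mult R ` carrier R"
      unfolding x(2) y(2) mult[OF x(1) y(1)] using x y by simp
    show "f \<oplus>\<^bsub>D\<^esub> g \<in> left_mult R ` carrier R"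
      unfolding x(2) y(2) add[OF x(1) y(1)] using x y by simp
  qed (rule image_subsetI, rule lmD)
  show "\<exists>g \<in> left_mult R ` carrier R. g \<otimes>\<^bsub>D\<^esub> f = \<one>\<^bsub>D\<^esub>"
    if f: "f \<in> left_mult R ` carrier R" "f \<noteq> \<zero>\<^bsub>D\<^esub>" for f
  proof -
    obtain x where x: "x \<in> carrier R" "f = left_mult R x" using f by blast
    then have "x \<noteq> \<zero>\<^bsub>R\<^esub>" using f zero by blast
    then obtain y where "y \<in> carrier R" "y \<otimes>\<^bsub>R\<^esub> x = \<one>\<^bsub>R\<^esub>" using inverse x by blast
    then show ?thesis using mult[of y x] x one by force
  qed
  show "\<exists>g \<in> left_mult R ` carrier R. \<delta> \<otimes>\<^bsub>D\<^esub> f = g \<oplus>\<^bsub>D\<^esub> f \<otimes>\<^bsub>D\<^esub> \<delta>"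
    if f: "f \<in> left_mult R ` carrier R" for f
  proof -
    obtain x where x: "x \<in> carrier R" "f = left_mult R x" using f by blast
    have dx: "\<delta> y \<in> carrier R" if "y \<in> carrier R" for y
      using that D_closed D_generators(1) by blast
    have "\<delta> \<otimes>\<^bsub>D\<^esub> f = left_mult R (\<delta> x) \<oplus>\<^bsub>D\<^esub> f \<otimes>\<^bsub>D\<^esub> \<delta>"
      by (rule D_ext)
         (use x dx lmD D_generators(1) in \<open>auto simp: left_mult_apply D_apply deriv_mult\<close>)
    then show ?thesis using x dx by blast
  qed
  show "carrier D \<subseteq> V"
    if "subgroup V (add_monoid D)" "\<one>\<^bsub>D\<^esub> \<in> V"
      "\<And>f v. \<lbrakk>f \<in> left_mult R ` carrier R; v \<in> V\<rbrakk> \<Longrightarrow> f \<otimes>\<^bsub>D\<^esub> v \<in> V"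
      "\<And>v. v \<in> V \<Longrightarrow> \<delta> \<otimes>\<^bsub>D\<^esub> v \<in> V" for V
    by (rule D_left_generated) (use that in blast)+
qed (use D.nontrivial_ring_axioms D.no_zero_divisors D_generators in blast)+

end

theorem proposition5:
  fixes k :: "('k, 'c) ring_scheme"
    and R :: "('k, 'r, 'd) module_scheme"
    and \<delta> :: "'r \<Rightarrow> 'r"
  assumes "differential_algebra k R \<delta>"
    and "weakly_fadelian (diff_op_algebra k R \<delta>)"
  shows "skew_field R \<and>
    fadelian (diff_op_algebra k R \<delta>) \<and>
    (\<forall>L \<in> carrier (diff_op_algebra k R \<delta>).
      L \<noteq> \<zero>\<^bsub>diff_op_algebra k R \<delta>\<^esub> \<longrightarrow> L ` carrier R = carrier R)"
proof -
  interpret weakly_fadelian_differential_algebra k R \<delta>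
    using assms
    by (simp add: weakly_fadelian_differential_algebra_def
        weakly_fadelian_differential_algebra_axioms_def)
  show ?thesis
    using skew_field D.fadelian_if_left_Ore[OF D.left_Ore] surjective by blast
qed

end
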